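(* For any $w\in\mathbb{R}^d$, let $Z^*$ be the set of optimal solutions of the 0-1 knapsack problem $$\max_{z\in\{0,1\}^n}\ \sum_{i=1}^nz_i\big(\|w^i\|_2^2-\|\max(|w^i|-\beta,0)\|_2^2\big)\quad\text{s.t. }\sum_{i=1}^nz_ip_i\le m,$$ where $\|\max(|w^i|-\beta,0)\|_2^2:=\sum_{j=1}^{d_i}(\max(|w^i_j|-\beta,0))^2$. Then the Euclidean projection of $w$ onto $C\cap\overline{B}_\beta$ equals $$\Pi_{C\cap\overline{B}_\beta}(w)=\{x\in\mathbb{R}^d:\exists z^*\in Z^*,\ x^i=\mathrm{sgn}(w^i)\min(|w^i|,\beta)\text{ if }z_i^*=1,\ x^i=0\text{ otherwise, }\forall i\in[n]\},$$ where $x^i=\mathrm{sgn}(w^i)\min(|w^i|,\beta)$ denotes $x^i_j=\mathrm{sgn}(w^i_j)\min(|w^i_j|,\beta)$ for $j=1,\dots,d_i$.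
   Context: $[n]:=\{1,\dots,n\}$. For $n\le d$, the coordinates of $w\in\mathbb{R}^d$ are partitioned into blocks $w^1,\dots,w^n$, with $w^i\in\mathbb{R}^{d_i}$ and $\sum_{i=1}^nd_i=d$. Let $m>0$ and $0<p_i\le m$ for $i\in[n]$. The weighted group $l_0$-norm constraint set is $C:=\{w\in\mathbb{R}^d:\sum_{i=1}^np_i\mathbb{1}_{\{w^i\ne0\}}(w)\le m\}$, where $\{w^i\neq0\}$ is the set of $w$ whose $i$-th block is not the zero vector. $\beta>0$ and $\overline{B}_\beta:=\{z\in\mathbb{R}^d:|z_i|\le\beta,\ i=1,\dots,d\}$. $\Pi_A(w)$ is the set of all nearest points of $A$ to $w$ in Euclidean norm. *)

theory Defs
  imports "HOL-Analysis.Analysis"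
begin

text \<open>
  A division of the coordinates of \<open>real ^ 'd\<close> into blocks indexed by \<open>'n\<close> is given by the map
  \<open>b :: 'd \<Rightarrow> 'n\<close> sending a coordinate to the index of its block, so \<open>d\<^sub>i = card {j. b j = i}\<close> and
  these sizes add up to \<open>CARD('d)\<close>. Blocks need not be contiguous.
\<close>

text \<open>
  The block \<open>w\<^sup>i\<close> is kept inside the ambient space, padded with zeros outside its own coordinates.
  This changes neither its Euclidean norm nor whether it vanishes.
\<close>

definition block :: "('d \<Rightarrow> 'n) \<Rightarrow> real ^ 'd \<Rightarrow> 'n \<Rightarrow> real ^ 'd" where
  "block b w i = (\<chi> j. if b j = i then w $ j else 0)"

definition group_l0_set :: "('d \<Rightarrow> 'n::finite) \<Rightarrow> ('n \<Rightarrow> real) \<Rightarrow> real \<Rightarrow> (real ^ 'd) set" where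
  "group_l0_set b p m = {w. (\<Sum>i\<in>UNIV. p i * indicator {v. block b v i \<noteq> 0} w) \<le> m}"

definition box_ball :: "real \<Rightarrow> (real ^ 'd) set" where
  "box_ball \<beta> = {z. \<forall>i. \<bar>z $ i\<bar> \<le> \<beta>}"

text \<open>The set of all nearest points; it may be empty or have several elements.\<close>

definition proj_set :: "'a::metric_space set \<Rightarrow> 'a \<Rightarrow> 'a set" where
  "proj_set A w = {x. is_arg_min (\<lambda>y. dist w y) (\<lambda>y. y \<in> A) x}"

definition knapsack_solutions ::
    "('n \<Rightarrow> real) \<Rightarrow> ('n \<Rightarrow> real) \<Rightarrow> real \<Rightarrow> (real ^ 'n::finite) set" where
  "knapsack_solutions v p m =
     {z. is_arg_max (\<lambda>y. \<Sum>i\<in>UNIV. y $ i * v i)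
           (\<lambda>y. (\<forall>i. y $ i \<in> {0, 1}) \<and> (\<Sum>i\<in>UNIV. y $ i * p i) \<le> m) z}"

definition block_gain :: "('d::finite \<Rightarrow> 'n) \<Rightarrow> real \<Rightarrow> real ^ 'd \<Rightarrow> 'n \<Rightarrow> real" where
  "block_gain b \<beta> w i =
     (norm (block b w i))\<^sup>2 - (\<Sum>j | b j = i. (max (\<bar>w $ j\<bar> - \<beta>) 0)\<^sup>2)"

end

theory Submission imports Defs
begin

text \<open>
  Writing \<open>c\<close> for the clipped coordinate of \<open>w\<close>, every \<open>x\<close> in \<open>[-\<beta>, \<beta>]\<close> satisfies
  \<open>(w - x)\<^sup>2 \<ge> (max (\<bar>w\<bar> - \<beta>) 0)\<^sup>2 + (x - c)\<^sup>2\<close>. Summing over coordinates, a point of the box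
  supported on the blocks chosen by \<open>z\<close> has squared distance to \<open>w\<close> at least \<open>\<parallel>w\<parallel>\<^sup>2\<close> minus the
  knapsack value of \<open>z\<close>, plus its squared distance to the point that clips \<open>w\<close> on the chosen
  blocks and vanishes elsewhere; that point attains the bound. So minimising the distance is
  maximising the knapsack value.
\<close>

definition clip_blocks :: "('d::finite \<Rightarrow> 'n::finite) \<Rightarrow> real \<Rightarrow> real ^ 'd \<Rightarrow> real ^ 'n \<Rightarrow> real ^ 'd" where
  "clip_blocks b \<beta> w z =
     (\<chi> j. if z $ b j = 1 then sgn (w $ j) * min \<bar>w $ j\<bar> \<beta> else 0)"

text \<open>The smallest 0-1 selection whose blocks carry all of \<open>x\<close>; it turns a point
  of the constraint set into a knapsack candidate.\<close>

definition block_support :: "('d::finite \<Rightarrow> 'n::finite) \<Rightarrow> real ^ 'd \<Rightarrow> real ^ 'n" where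
  "block_support b x = (\<chi> i. if block b x i = 0 then 0 else 1)"

lemma block_eq_0_iff: "block b x i = 0 \<longleftrightarrow> (\<forall>j. b j = i \<longrightarrow> x $ j = 0)"
  by (auto simp: block_def vec_eq_iff)

lemma power2_diff_clip:
  fixes w \<beta> :: real
  assumes "\<beta> > 0"
  shows "(w - sgn w * min \<bar>w\<bar> \<beta>)\<^sup>2 = (max (\<bar>w\<bar> - \<beta>) 0)\<^sup>2"
  using assms by (auto simp: sgn_if min_def max_def abs_if power2_eq_square algebra_simps)

text \<open>The clipped value \<open>c\<close> is the nearest point of the interval
  [-\<beta>, \<beta>] to \<open>w\<close>. If \<open>w\<close> lies outside, \<open>c\<close> is an
  endpoint, so \<open>w - c\<close> and \<open>c - x\<close> never have opposite signs; expanding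
  the square around \<open>c\<close> leaves this nonnegative product as the only slack.\<close>

lemma power2_diff_clip_le:
  fixes w x \<beta> :: real
  assumes "\<beta> > 0" "\<bar>x\<bar> \<le> \<beta>"
  shows "(max (\<bar>w\<bar> - \<beta>) 0)\<^sup>2 + (x - sgn w * min \<bar>w\<bar> \<beta>)\<^sup>2 \<le> (w - x)\<^sup>2"
proof -
  define c where "c = sgn w * min \<bar>w\<bar> \<beta>"
  consider "\<bar>w\<bar> \<le> \<beta>" "c = w" | "w > \<beta>" "c = \<beta>" | "w < - \<beta>" "c = - \<beta>"
    using assms(1) by (cases "\<bar>w\<bar> \<le> \<beta>") (auto simp: c_def sgn_if min_def abs_if split: if_splits)
  then have "0 \<le> (w - c) * (c - x)"
    by cases (use assms(2) in \<open>auto intro!: mult_nonneg_nonneg mult_nonpos_nonpos\<close>)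
  moreover have "(w - x)\<^sup>2 = (w - c)\<^sup>2 + (x - c)\<^sup>2 + 2 * ((w - c) * (c - x))"
    by (simp add: power2_eq_square algebra_simps)
  ultimately show ?thesis
    using power2_diff_clip[OF assms(1), of w] by (simp add: c_def)
qed

lemma dist_power2_vec: "(dist x y)\<^sup>2 = (\<Sum>j\<in>UNIV. (x $ j - y $ j)\<^sup>2)" for x y :: "real ^ 'd"
  unfolding dist_norm power2_norm_eq_inner inner_vec_def by (simp add: power2_eq_square)

lemma norm_power2_vec: "(norm x)\<^sup>2 = (\<Sum>j\<in>UNIV. (x $ j)\<^sup>2)" for x :: "real ^ 'd"
  using dist_power2_vec[of x 0] by simp

lemma norm_block_power2: "(norm (block b w i))\<^sup>2 = (\<Sum>j | b j = i. (w $ j)\<^sup>2)"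
proof -
  have "(norm (block b w i))\<^sup>2 = (\<Sum>j\<in>UNIV. if b j = i then (w $ j)\<^sup>2 else 0)"
    unfolding norm_power2_vec by (rule sum.cong) (auto simp: block_def)
  then show ?thesis
    by (simp add: sum.If_cases)
qed

text \<open>Each coordinate lies in exactly one block, so the value regroups over coordinates. This
  lets the distance estimates below be checked one coordinate at a time.\<close>

lemma sum_block_gain:
  "(\<Sum>i\<in>UNIV. z $ i * block_gain b \<beta> w i) =
   (\<Sum>j\<in>UNIV. z $ b j * ((w $ j)\<^sup>2 - (max (\<bar>w $ j\<bar> - \<beta>) 0)\<^sup>2))"
proof -
  have "z $ i * block_gain b \<beta> w i =
      (\<Sum>j | j \<in> UNIV \<and> b j = i. z $ b j * ((w $ j)\<^sup>2 - (max (\<bar>w $ j\<bar> - \<beta>) 0)\<^sup>2))" for i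
    unfolding block_gain_def norm_block_power2 sum_subtractf[symmetric] sum_distrib_left
    by (rule sum.cong) auto
  then show ?thesis
    by (simp only: sum.group[OF finite finite subset_UNIV])
qed

lemma dist_clip_blocks:
  assumes "\<beta> > 0" "\<forall>i. z $ i \<in> {0, 1}"
  shows "(dist w (clip_blocks b \<beta> w z))\<^sup>2 =
    (norm w)\<^sup>2 - (\<Sum>i\<in>UNIV. z $ i * block_gain b \<beta> w i)"
  unfolding sum_block_gain dist_power2_vec norm_power2_vec sum_subtractf[symmetric]
proof (rule sum.cong[OF refl])
  fix j
  have "z $ b j = 0 \<or> z $ b j = 1"
    using assms(2) by blast
  then show "(w $ j - clip_blocks b \<beta> w z $ j)\<^sup>2 =
      (w $ j)\<^sup>2 - z $ b j * ((w $ j)\<^sup>2 - (max (\<bar>w $ j\<bar> - \<beta>) 0)\<^sup>2)"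
    using power2_diff_clip[OF assms(1), of "w $ j"] by (auto simp: clip_blocks_def)
qed

text \<open>On the support blocks this is the clipping inequality; elsewhere \<open>x\<close> and
  the clipped point are both zero and equality holds. The extra squared distance is kept because it
  later forces a minimiser to be a clipped point.\<close>

lemma dist_box_ball_ge:
  fixes b :: "'d::finite \<Rightarrow> 'n::finite" and w x :: "real ^ 'd"
  assumes "\<beta> > 0" "x \<in> box_ball \<beta>"
  defines "z \<equiv> block_support b x"
  shows "(norm w)\<^sup>2 - (\<Sum>i\<in>UNIV. z $ i * block_gain b \<beta> w i) +
    (dist x (clip_blocks b \<beta> w z))\<^sup>2 \<le> (dist w x)\<^sup>2"
  unfolding sum_block_gain dist_power2_vec norm_power2_vec
    sum_subtractf[symmetric] sum.distrib[symmetric]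
proof (rule sum_mono)
  fix j
  have "\<bar>x $ j\<bar> \<le> \<beta>"
    using assms(2) by (simp add: box_ball_def)
  moreover have "z $ b j = 1 \<or> z $ b j = 0 \<and> x $ j = 0"
    by (auto simp: z_def block_support_def block_eq_0_iff)
  ultimately show "(w $ j)\<^sup>2 - z $ b j * ((w $ j)\<^sup>2 - (max (\<bar>w $ j\<bar> - \<beta>) 0)\<^sup>2) +
      (x $ j - clip_blocks b \<beta> w z $ j)\<^sup>2 \<le> (w $ j - x $ j)\<^sup>2"
    using power2_diff_clip_le[OF assms(1), of "x $ j" "w $ j"] by (auto simp: clip_blocks_def)
qed

lemma group_l0_set_iff:
  "x \<in> group_l0_set b p m \<longleftrightarrow> (\<Sum>i\<in>UNIV. block_support b x $ i * p i) \<le> m"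
proof -
  have "p i * indicator {v. block b v i \<noteq> 0} x = block_support b x $ i * p i" for i
    by (simp add: block_support_def)
  then show ?thesis
    by (simp only: group_l0_set_def mem_Collect_eq)
qed

lemma clip_blocks_in_box_ball: "\<beta> > 0 \<Longrightarrow> clip_blocks b \<beta> w z \<in> box_ball \<beta>"
  by (auto simp: box_ball_def clip_blocks_def abs_mult sgn_if)

text \<open>A chosen block on which \<open>w\<close> vanishes stays zero after clipping, so the
  support may be smaller than \<open>z\<close>. Since weights are positive, this can only lower the
  cost.\<close>

lemma clip_blocks_in_group_l0_set:
  assumes "\<And>i. 0 < p i" "\<forall>i. z $ i \<in> {0, 1}" "(\<Sum>i\<in>UNIV. z $ i * p i) \<le> m"
  shows "clip_blocks b \<beta> w z \<in> group_l0_set b p m"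
proof -
  have "block_support b (clip_blocks b \<beta> w z) $ i \<le> z $ i" for i
  proof -
    have "z $ i = 0 \<or> z $ i = 1"
      using assms(2) by blast
    then show ?thesis
      by (auto simp: block_support_def block_eq_0_iff clip_blocks_def)
  qed
  then have "(\<Sum>i\<in>UNIV. block_support b (clip_blocks b \<beta> w z) $ i * p i) \<le> (\<Sum>i\<in>UNIV. z $ i * p i)"
    using assms(1) by (intro sum_mono mult_right_mono) (auto simp: less_imp_le)
  with assms(3) show ?thesis
    by (simp add: group_l0_set_iff)
qed

lemma eq_clip_blocks_iff:
  "x = clip_blocks b \<beta> w z \<longleftrightarrow>
    (\<forall>i. if z $ i = 1 then (\<forall>j. b j = i \<longrightarrow> x $ j = sgn (w $ j) * min \<bar>w $ j\<bar> \<beta>)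
         else block b x i = 0)"
  unfolding block_eq_0_iff by (auto simp: clip_blocks_def vec_eq_iff)

theorem proposition8:
  fixes b :: "'d::finite \<Rightarrow> 'n::finite"
    and p :: "'n \<Rightarrow> real"
    and m \<beta> :: real
    and w :: "real ^ 'd"
  assumes "CARD('n) \<le> CARD('d)"
    and "m > 0"
    and "\<And>i. 0 < p i" and "\<And>i. p i \<le> m"
    and "\<beta> > 0"
  shows "proj_set (group_l0_set b p m \<inter> box_ball \<beta>) w =
    {x. \<exists>z \<in> knapsack_solutions (block_gain b \<beta> w) p m. \<forall>i.
          if z $ i = 1 then (\<forall>j. b j = i \<longrightarrow> x $ j = sgn (w $ j) * min \<bar>w $ j\<bar> \<beta>)
          else block b x i = 0}"
proof -
  let ?S = "group_l0_set b p m \<inter> box_ball \<beta>"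
  let ?val = "\<lambda>z. \<Sum>i\<in>UNIV. z $ i * block_gain b \<beta> w i"
  let ?clip = "clip_blocks b \<beta> w"
  define feasible where
    "feasible z \<longleftrightarrow> (\<forall>i. z $ i \<in> {0, 1::real}) \<and> (\<Sum>i\<in>UNIV. z $ i * p i) \<le> m" for z
  have knapsack: "z \<in> knapsack_solutions (block_gain b \<beta> w) p m \<longleftrightarrow>
      feasible z \<and> (\<forall>z'. feasible z' \<longrightarrow> ?val z' \<le> ?val z)" for z
    unfolding knapsack_solutions_def is_arg_max_linorder feasible_def by auto
  have proj: "x \<in> proj_set ?S w \<longleftrightarrow> x \<in> ?S \<and> (\<forall>y\<in>?S. (dist w x)\<^sup>2 \<le> (dist w y)\<^sup>2)" for x
    unfolding proj_set_def is_arg_min_linorder by (auto simp: power_mono_iff)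
  have clip_in: "?clip z \<in> ?S" if "feasible z" for z
    using that clip_blocks_in_group_l0_set[OF assms(3)] clip_blocks_in_box_ball[OF assms(5)]
    by (auto simp: feasible_def)
  have clip_dist: "(dist w (?clip z))\<^sup>2 = (norm w)\<^sup>2 - ?val z" if "feasible z" for z
    using that dist_clip_blocks[OF assms(5)] unfolding feasible_def by blast
  have support: "feasible (block_support b x)" if "x \<in> ?S" for x
  proof -
    have "block_support b x $ i \<in> {0, 1}" for i
      by (simp add: block_support_def)
    then show ?thesis
      using that unfolding feasible_def Int_iff group_l0_set_iff by blast
  qed
  have lower: "(norm w)\<^sup>2 - ?val (block_support b x) +
      (dist x (?clip (block_support b x)))\<^sup>2 \<le> (dist w x)\<^sup>2" if "x \<in> ?S" for x
    using that dist_box_ball_ge[OF assms(5)] by blast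
  have "x \<in> proj_set ?S w \<longleftrightarrow>
      (\<exists>z \<in> knapsack_solutions (block_gain b \<beta> w) p m. x = ?clip z)" for x
  proof
    assume x: "x \<in> proj_set ?S w"
    \<comment> \<open>The support of \<open>x\<close> itself serves as the optimal
      selection.\<close>
    define z where "z = block_support b x"
    have xS: "x \<in> ?S" and z: "feasible z"
      using x support unfolding proj z_def by blast+
    have upper: "(dist w x)\<^sup>2 \<le> (norm w)\<^sup>2 - ?val z'" if "feasible z'" for z'
    proof -
      have "(dist w x)\<^sup>2 \<le> (dist w (?clip z'))\<^sup>2"
        using x clip_in[OF that] unfolding proj by blast
      then show ?thesis
        by (simp only: clip_dist[OF that])
    qed
    \<comment> \<open>The lower bound at \<open>x\<close> meets the upper bound from comparing
      \<open>x\<close> with the clipped point of \<open>z'\<close>. Dropping the square gives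
      optimality of \<open>z\<close>; the case \<open>z' = z\<close> makes the square
      vanish.\<close>
    have "?val z' + (dist x (?clip z))\<^sup>2 \<le> ?val z" if "feasible z'" for z'
      using lower[OF xS] upper[OF that] unfolding z_def by linarith
    then have "?val z' \<le> ?val z" if "feasible z'" for z'
      using that by (meson add_increasing2 order_trans order_refl zero_le_power2)
    moreover have "(dist x (?clip z))\<^sup>2 \<le> 0"
      using lower[OF xS] upper[OF z] unfolding z_def by linarith
    then have "x = ?clip z"
      by simp
    ultimately show "\<exists>z \<in> knapsack_solutions (block_gain b \<beta> w) p m. x = ?clip z"
      using z knapsack by blast
  next
    assume "\<exists>z \<in> knapsack_solutions (block_gain b \<beta> w) p m. x = ?clip z"
    then obtain z where z: "feasible z" "\<And>z'. feasible z' \<Longrightarrow> ?val z' \<le> ?val z" "x = ?clip z"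
      using knapsack by blast
    \<comment> \<open>The support of \<open>y\<close> is feasible, so its value is at most that of
      \<open>z\<close>, whose clipped point attains the bound exactly.\<close>
    have "(dist w x)\<^sup>2 \<le> (dist w y)\<^sup>2" if "y \<in> ?S" for y
      using lower[OF that] z(2)[OF support[OF that]] clip_dist[OF z(1)]
        zero_le_power2[of "dist y (?clip (block_support b y))"]
      unfolding z(3) by linarith
    then show "x \<in> proj_set ?S w"
      using clip_in[OF z(1)] z(3) unfolding proj by blast
  qed
  then show ?thesis
    unfolding eq_clip_blocks_iff by blast
qed

end
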